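(* Let $f:\mathbb{R}^n\to\mathbb{R}$ and $G:\mathbb{R}^n\to S^p$ be twice continuously differentiable, and let $(\bar x,\bar y)$ be a KKT point of the problem $\min f(x)$ s.t. $G(x)\in S^p_+$. Then the multiplier $\bar y$ is noncritical if and only if every pair $(\xi,\eta)\in\mathbb{R}^n\times S^p$ satisfying $$\nabla^2_{xx}L(\bar x,\bar y)\xi+G'(\bar x)^*\eta=0,\qquad G'(\bar x)\xi-\Pi'_{S^p_+}\big(G(\bar x)+\bar y;\,G'(\bar x)\xi+\eta\big)=0$$ has $\xi=0$.
   Context: $S^p$ is the space of real symmetric $p\times p$ matrices with the trace inner product; $S^p_+$ is the cone of positive semidefinite matrices. $L(x,y)=f(x)+\langle y,G(x)\rangle$ for $(x,y)\in\mathbb{R}^n\times S^p$. $G'(\bar x):\mathbb{R}^n\to S^p$ is the derivative and $G'(\bar x)^*$ its adjoint. $N(x;\Omega)$ is the normal cone of convex analysis to the convex set $\Omega$ at $x\in\Omega$, and empty if $x\notin\Omega$. For feasible $\bar x$, the set of Lagrange multipliers is $\Lambda(\bar x)=\{y\in S^p:\nabla_xL(\bar x,y)=0,\ y\in N(G(\bar x);S^p_+)\}$; $(\bar x,\bar y)$ is a KKT point if $\bar x$ is feasible and $\bar y\in\Lambda(\bar x)$. $\Pi_{S^p_+}$ is the metric projection onto $S^p_+$ and $\Pi'_{S^p_+}(Z;H)$ its directional derivative at $Z$ in direction $H$. For a set $\Omega$ in a finite-dimensional Hilbert space and $z\in\Omega$, the tangent cone is $T(z;\Omega)=\limsup_{t\downarrow0}(\Omega-z)/t$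 (outer limit). For a set-valued mapping $F$ with $(u,v)\in\operatorname{gph}F$, the graphical derivative is $DF(u,v)(h)=\{k:(h,k)\in T((u,v);\operatorname{gph}F)\}$. Let $\mathcal N:S^p\rightrightarrows S^p$, $\mathcal N(X)=N(X;S^p_+)$ (the subdifferential of the indicator function of $S^p_+$). A multiplier $\bar y\in\Lambda(\bar x)$ is critical if there is $\xi\in\mathbb{R}^n$, $\xi\neq0$, with $0\in\nabla^2_{xx}L(\bar x,\bar y)\xi+G'(\bar x)^*\,D\mathcal N(G(\bar x),\bar y)(G'(\bar x)\xi)$; it is noncritical otherwise, i.e. if this inclusion has only the solution $\xi=0$. *)

theory Defs
  imports "HOL-Analysis.Analysis"
begin

(* The space S^p is rendered as the subspace sym_mats of real^'p^'p.  On it the ambient inner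
   product is the trace inner product (lemma sym_mats_inner_eq_trace). *)

definition sym_mats :: "(real^'p^'p) set" where
  "sym_mats = {A. transpose A = A}"

definition psd_cone :: "(real^'p^'p) set" where
  "psd_cone = {A \<in> sym_mats. \<forall>v. 0 \<le> v \<bullet> (A *v v)}"

lemma subspace_sym_mats: "subspace sym_mats"
  by (auto simp: sym_mats_def subspace_def transpose_def vec_eq_iff)

lemma sym_mats_inner_eq_trace:
  assumes "A \<in> sym_mats"
  shows "A \<bullet> B = trace (A ** B)"
proof -
  have tr: "transpose A = A"
    using assms by (simp add: sym_mats_def)
  have "A $ i $ j = A $ j $ i" for i j
    by (subst (1) tr [symmetric]) (simp add: transpose_def)
  then have "(\<Sum>i\<in>UNIV. \<Sum>j\<in>UNIV. A $ i $ j * B $ i $ j)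
      = (\<Sum>i\<in>UNIV. \<Sum>j\<in>UNIV. A $ j $ i * B $ i $ j)"
    by (intro sum.cong refl arg_cong2 [where f = "(*)"])
  then have "A \<bullet> B = (\<Sum>i\<in>UNIV. \<Sum>j\<in>UNIV. A $ j $ i * B $ i $ j)"
    by (simp only: inner_vec_def inner_real_def)
  also have "\<dots> = trace (A ** B)"
    unfolding trace_def matrix_matrix_mult_def by (simp only: vec_lambda_beta) (rule sum.swap)
  finally show ?thesis .
qed

definition twice_continuously_differentiable ::
    "('a::real_normed_vector \<Rightarrow> 'b::real_normed_vector) \<Rightarrow> bool" where
  "twice_continuously_differentiable F \<longleftrightarrow>
    (\<exists>(F' :: 'a \<Rightarrow> 'a \<Rightarrow>\<^sub>L 'b) (F'' :: 'a \<Rightarrow> 'a \<Rightarrow>\<^sub>L ('a \<Rightarrow>\<^sub>L 'b)).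
      (\<forall>x. (F has_derivative blinfun_apply (F' x)) (at x)) \<and>
      (\<forall>x. (F' has_derivative blinfun_apply (F'' x)) (at x)) \<and>
      continuous_on UNIV F'')"

definition gradient :: "('a::real_inner \<Rightarrow> real) \<Rightarrow> 'a \<Rightarrow> 'a" where
  "gradient \<phi> x = (THE g. GDERIV \<phi> x :> g)"

definition hessian :: "('a::real_inner \<Rightarrow> real) \<Rightarrow> 'a \<Rightarrow> 'a \<Rightarrow> 'a" where
  "hessian \<phi> x = frechet_derivative (gradient \<phi>) (at x)"

definition directional_derivative ::
    "('a::real_normed_vector \<Rightarrow> 'b::real_normed_vector) \<Rightarrow> 'a \<Rightarrow> 'a \<Rightarrow> 'b" where
  "directional_derivative F z h = Lim (at_right 0) (\<lambda>t. (F (z + t *\<^sub>R h) - F z) /\<^sub>R t)"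

(* The outer limit of (\<Omega> - z)/t as t decreases to 0, in terms of sequences. *)
definition tangent_cone :: "'a::real_normed_vector \<Rightarrow> 'a set \<Rightarrow> 'a set" where
  "tangent_cone z \<Omega> =
    {w. \<exists>(t :: nat \<Rightarrow> real) W.
        (\<forall>k. 0 < t k) \<and> t \<longlonglongrightarrow> 0 \<and> W \<longlonglongrightarrow> w \<and>
        (\<forall>k. W k \<in> (\<lambda>u. (u - z) /\<^sub>R t k) ` \<Omega>)}"

definition gph :: "('a \<Rightarrow> 'b set) \<Rightarrow> ('a \<times> 'b) set" where
  "gph F = {(u, v). v \<in> F u}"

definition graphical_derivative ::
    "('a::real_normed_vector \<Rightarrow> 'b::real_normed_vector set) \<Rightarrow> 'a \<Rightarrow> 'b \<Rightarrow> 'a \<Rightarrow> 'b set" where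
  "graphical_derivative F u v h = {k. (h, k) \<in> tangent_cone (u, v) (gph F)}"

(* The normal cone is taken inside the subspace V, which plays the role of the whole space. *)
definition normal_cone_in :: "'a::real_inner set \<Rightarrow> 'a \<Rightarrow> 'a set \<Rightarrow> 'a set" where
  "normal_cone_in V x \<Omega> = {v \<in> V. x \<in> \<Omega> \<and> (\<forall>z\<in>\<Omega>. v \<bullet> (z - x) \<le> 0)}"

(* Since S^p is closed, gph normal_psd and its tangent cones lie in S^p x S^p, so the graphical
   derivative of this mapping is the same whether taken in S^p or in the space of all matrices. *)
definition normal_psd :: "real^'p^'p \<Rightarrow> (real^'p^'p) set" where
  "normal_psd X = normal_cone_in sym_mats X psd_cone"

definition lagrangian ::
    "(real^'n \<Rightarrow> real) \<Rightarrow> (real^'n \<Rightarrow> real^'p^'p) \<Rightarrow> real^'n \<Rightarrow> real^'p^'p \<Rightarrow> real" where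
  "lagrangian f G x y = f x + y \<bullet> G x"

definition multipliers ::
    "(real^'n \<Rightarrow> real) \<Rightarrow> (real^'n \<Rightarrow> real^'p^'p) \<Rightarrow> real^'n \<Rightarrow> (real^'p^'p) set" where
  "multipliers f G x =
    {y \<in> sym_mats. gradient (\<lambda>u. lagrangian f G u y) x = 0 \<and> y \<in> normal_psd (G x)}"

definition kkt_point ::
    "(real^'n \<Rightarrow> real) \<Rightarrow> (real^'n \<Rightarrow> real^'p^'p) \<Rightarrow> real^'n \<Rightarrow> real^'p^'p \<Rightarrow> bool" where
  "kkt_point f G x y \<longleftrightarrow> G x \<in> psd_cone \<and> y \<in> multipliers f G x"

(* When G takes values in S^p, the adjoint of G'(x) as a map into all matrices restricts on S^p
   to its adjoint as a map into S^p; below it is only applied to symmetric matrices. *)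
definition critical_multiplier ::
    "(real^'n \<Rightarrow> real) \<Rightarrow> (real^'n \<Rightarrow> real^'p^'p) \<Rightarrow> real^'n \<Rightarrow> real^'p^'p \<Rightarrow> bool" where
  "critical_multiplier f G x y \<longleftrightarrow> y \<in> multipliers f G x \<and>
    (\<exists>\<xi>. \<xi> \<noteq> 0 \<and>
      0 \<in> (\<lambda>\<eta>. hessian (\<lambda>u. lagrangian f G u y) x \<xi>
                 + adjoint (frechet_derivative G (at x)) \<eta>) `
           graphical_derivative normal_psd (G x) y (frechet_derivative G (at x) \<xi>))"

definition noncritical_multiplier ::
    "(real^'n \<Rightarrow> real) \<Rightarrow> (real^'n \<Rightarrow> real^'p^'p) \<Rightarrow> real^'n \<Rightarrow> real^'p^'p \<Rightarrow> bool" where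
  "noncritical_multiplier f G x y \<longleftrightarrow> y \<in> multipliers f G x \<and> \<not> critical_multiplier f G x y"

end

theory Submission
  imports Defs
begin

text \<open>The graph of the normal cone mapping of \<open>S\<^sup>p\<^sub>+\<close> is parametrised by \<open>Z \<mapsto> (\<Pi>(Z), Z - \<Pi>(Z))\<close>, and
  \<open>\<Pi>\<close> is nonexpansive.  So once \<open>\<Pi>\<close> is known to be directionally differentiable,
  \<open>E \<in> D\<N>(X, Y)(H)\<close> means \<open>H = \<Pi>'(X + Y; H + E)\<close>, and the theorem is a substitution.
  The difference quotients of \<open>\<Pi>\<close> are bounded, so it suffices that they have a single cluster
  point.  A cluster point \<open>W\<close> in direction \<open>H\<close>, with \<open>V = H - W\<close>, satisfies the linearisation
  \<open>X V + W Y = 0\<close> of the complementarity relation \<open>X Y = 0\<close>, and compressing \<open>W\<close> and \<open>V\<close> to the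
  kernel of \<open>X + Y\<close> gives again a complementary pair of a positive and a negative semidefinite
  matrix.  The difference of two such \<open>W\<close> lives on that kernel by the first relation and vanishes
  there by the second.\<close>

subsection \<open>Matrix algebra\<close>

text \<open>Bilinearity supplies the rewrite rules \<open>mult_mat_simps\<close>; boundedness
  supplies limits of products, on which \<open>split_tangent_limit\<close> relies.\<close>

lemma bounded_bilinear_matrix_mult:
  "bounded_bilinear ((**) :: real^'n^'m \<Rightarrow> real^'k^'n \<Rightarrow> real^'k^'m)"
proof -
  have "bilinear ((**) :: real^'n^'m \<Rightarrow> real^'k^'n \<Rightarrow> real^'k^'m)"
    unfolding bilinear_def
    by (auto intro!: linearI
        simp: vec_eq_iff matrix_matrix_mult_def algebra_simps sum.distrib sum_distrib_left)
  then show ?thesis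
    by (simp add: bilinear_conv_bounded_bilinear)
qed

lemmas mult_mat_simps =
  bounded_bilinear.add_left [OF bounded_bilinear_matrix_mult]
  bounded_bilinear.add_right [OF bounded_bilinear_matrix_mult]
  bounded_bilinear.diff_left [OF bounded_bilinear_matrix_mult]
  bounded_bilinear.diff_right [OF bounded_bilinear_matrix_mult]
  bounded_bilinear.minus_left [OF bounded_bilinear_matrix_mult]
  bounded_bilinear.minus_right [OF bounded_bilinear_matrix_mult]
  bounded_bilinear.scaleR_left [OF bounded_bilinear_matrix_mult]
  bounded_bilinear.scaleR_right [OF bounded_bilinear_matrix_mult]
  bounded_bilinear.zero_left [OF bounded_bilinear_matrix_mult]
  bounded_bilinear.zero_right [OF bounded_bilinear_matrix_mult]

lemmas tendsto_mat_mult = bounded_bilinear.tendsto [OF bounded_bilinear_matrix_mult]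

lemma transpose_add: "transpose (A + B) = transpose A + transpose B"
  and transpose_diff: "transpose (A - B) = transpose A - transpose B"
  and transpose_uminus: "transpose (- A) = - transpose A"
  and transpose_zero: "transpose 0 = 0"
  for A B :: "real^'n^'m"
  by (simp_all add: transpose_def vec_eq_iff)

lemmas transpose_mat_simps =
  transpose_add transpose_diff transpose_uminus transpose_zero transpose_scalar

lemma sym_mats_transpose: "A \<in> sym_mats \<Longrightarrow> transpose A = A"
  by (simp add: sym_mats_def)

section \<open>Adjoints of left and right multiplication for the Frobenius inner product\<close>

lemma inner_mult_left:
  fixes A :: "real^'n^'m" and B :: "real^'k^'n"
  shows "(A ** B) \<bullet> C = B \<bullet> (transpose A ** C)"
proof -
  have "(A ** B) \<bullet> C = (\<Sum>i\<in>UNIV. \<Sum>j\<in>UNIV. \<Sum>k\<in>UNIV. A $ i $ k * B $ k $ j * C $ i $ j)"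
    by (simp add: inner_vec_def matrix_matrix_mult_def sum_distrib_right)
  also have "\<dots> = (\<Sum>i\<in>UNIV. \<Sum>k\<in>UNIV. \<Sum>j\<in>UNIV. A $ i $ k * B $ k $ j * C $ i $ j)"
    by (intro sum.cong refl sum.swap)
  also have "\<dots> = (\<Sum>k\<in>UNIV. \<Sum>i\<in>UNIV. \<Sum>j\<in>UNIV. A $ i $ k * B $ k $ j * C $ i $ j)"
    by (rule sum.swap)
  also have "\<dots> = (\<Sum>k\<in>UNIV. \<Sum>j\<in>UNIV. \<Sum>i\<in>UNIV. A $ i $ k * B $ k $ j * C $ i $ j)"
    by (intro sum.cong refl sum.swap)
  also have "\<dots> = B \<bullet> (transpose A ** C)"
    by (simp add: inner_vec_def matrix_matrix_mult_def transpose_def sum_distrib_left mult_ac)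
  finally show ?thesis .
qed

lemma inner_transpose:
  fixes A B :: "real^'n^'m"
  shows "transpose A \<bullet> transpose B = A \<bullet> B"
  by (simp add: inner_vec_def transpose_def) (rule sum.swap)

lemma inner_mult_right:
  fixes A :: "real^'n^'m" and B :: "real^'k^'n"
  shows "(A ** B) \<bullet> C = A \<bullet> (C ** transpose B)"
proof -
  have "(A ** B) \<bullet> C = (transpose B ** transpose A) \<bullet> transpose C"
    by (metis inner_transpose matrix_transpose_mul)
  also have "\<dots> = transpose A \<bullet> transpose (C ** transpose B)"
    by (simp add: inner_mult_left matrix_transpose_mul)
  finally show ?thesis
    by (simp add: inner_transpose)
qed

text \<open>The trace of \<open>transpose A ** A\<close> is \<open>A \<bullet> A\<close>. The
  typical use is cancellation: for symmetric \<open>S\<close>, \<open>S ** (S ** M) = 0\<close>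
  implies \<open>S ** M = 0\<close>.\<close>

lemma transpose_mult_self_eq_0:
  fixes A :: "real^'n^'m"
  assumes "transpose A ** A = 0"
  shows "A = 0"
proof -
  have "A \<bullet> A = (A ** mat 1) \<bullet> A" by simp
  also have "\<dots> = 0" by (simp only: inner_mult_left assms inner_zero_right)
  finally show ?thesis by simp
qed

text \<open>\<open>P\<close> is the orthogonal projection onto the kernel of \<open>Z\<close>,
  obtained without diagonalising: range and kernel of a symmetric matrix are orthogonal complements.
  \<open>K\<close> records that \<open>mat 1 - P\<close> maps into the range of \<open>Z\<close>;
  its columns are preimages of the range components of the unit vectors.\<close>

lemma ker_projection:
  fixes Z :: "real^'n^'n"
  assumes "Z \<in> sym_mats"
  obtains P K where "P \<in> sym_mats" "P ** P = P" "Z ** P = 0" "mat 1 = P + Z ** K"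
proof -
  have "\<exists>k. Z *v (axis i 1 - Z *v k) = 0" for i
  proof -
    have sub: "span (range ((*v) Z)) = range ((*v) Z)"
      by (simp add: linear_subspace_image)
    obtain y z where yz: "y \<in> span (range ((*v) Z))"
      "\<And>w. w \<in> span (range ((*v) Z)) \<Longrightarrow> orthogonal z w" "axis i 1 = y + z"
      using orthogonal_subspace_decomp_exists [of "range ((*v) Z)" "axis i 1"] by blast
    obtain k where k: "y = Z *v k" using yz(1) sub by auto
    have "(Z *v z) \<bullet> w = 0" for w
    proof -
      have "(Z *v z) \<bullet> w = z \<bullet> (Z *v w)"
        using assms by (metis dot_lmul_matrix sym_mats_transpose transpose_matrix_vector)
      also have "\<dots> = 0" using yz(2) sub by (auto simp: orthogonal_def)
      finally show ?thesis .
    qed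
    then have "Z *v z = 0" by (metis inner_eq_zero_iff)
    then show ?thesis using yz(3) k by (metis add_diff_cancel_left')
  qed
  then obtain k where k: "\<And>i. Z *v (axis i 1 - Z *v k i) = 0" by metis
  define K :: "real^'n^'n" where "K = (\<chi> i j. k j $ i)"
  define P where "P = mat 1 - Z ** K"
  have col: "A ** B = (\<chi> i j. (A *v column j B) $ i)" for A B :: "real^'n^'n"
    by (simp add: matrix_matrix_mult_def matrix_vector_mult_def column_def vec_eq_iff)
  have colP: "column j P = axis j 1 - Z *v k j" for j
    by (simp add: P_def K_def vec_eq_iff column_def mat_def axis_def matrix_matrix_mult_def
        matrix_vector_mult_def eq_commute)
  then have ZP: "Z ** P = 0" using k by (simp add: col colP vec_eq_iff)
  then have PZ: "transpose P ** Z = 0"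
    by (metis assms matrix_transpose_mul sym_mats_transpose transpose_zero)
  \<comment> \<open>\<open>transpose P\<close> annihilates \<open>Z\<close>, so only
    \<open>mat 1\<close> survives from the right factor. Thus \<open>transpose P\<close> equals a
    symmetric product, which yields symmetry and idempotence together.\<close>
  have PP: "transpose P ** P = transpose P"
  proof -
    have "transpose P ** P = transpose P ** mat 1 - (transpose P ** Z) ** K"
      by (subst (2) P_def) (simp only: mult_mat_simps matrix_mul_assoc)
    then show ?thesis by (simp add: PZ mult_mat_simps)
  qed
  have "transpose (transpose P ** P) = transpose P ** P"
    by (simp add: matrix_transpose_mul)
  with PP have tP: "transpose P = P" by simp
  show ?thesis
  proof
    show "P \<in> sym_mats" "P ** P = P" using tP PP by (simp_all add: sym_mats_def)
    show "Z ** P = 0" by (rule ZP)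
    show "mat 1 = P + Z ** K" by (simp add: P_def)
  qed
qed

lemma quadratic_nonneg_linear_coeff_0:
  fixes a b :: real
  assumes "\<And>e. 0 \<le> e * a + e\<^sup>2 * b"
  shows "a = 0"
proof (rule ccontr)
  assume a: "a \<noteq> 0"
  \<comment> \<open>With \<open>c\<close> positive and above \<open>b\<close>, the point
    \<open>e = - a / c\<close> gives the negative value
    \<open>a\<^sup>2 * (b - c) / c\<^sup>2\<close>.\<close>
  define c where "c = \<bar>b\<bar> + 1"
  have c: "c > 0" "b < c" by (auto simp: c_def)
  have "(- a / c) * a + (- a / c)\<^sup>2 * b = a\<^sup>2 * (b - c) / c\<^sup>2"
    using c by (simp add: field_simps power2_eq_square)
  also have "\<dots> < 0"
    using a c by (intro divide_neg_pos mult_pos_neg) auto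
  finally show False using assms [of "- a / c"] by simp
qed

subsection \<open>The positive semidefinite cone\<close>

lemma psd_cone_sym: "A \<in> psd_cone \<Longrightarrow> A \<in> sym_mats"
  by (simp add: psd_cone_def)

lemma psd_cone_transpose: "A \<in> psd_cone \<Longrightarrow> transpose A = A"
  by (simp add: psd_cone_def sym_mats_def)

lemma neg_psd_cone_transpose: "- A \<in> psd_cone \<Longrightarrow> transpose A = A"
  using psd_cone_transpose [of "- A"] by (simp add: transpose_uminus)

lemma zero_in_psd_cone: "0 \<in> psd_cone"
  by (simp add: psd_cone_def sym_mats_def transpose_mat_simps)

lemma psd_cone_nonempty: "psd_cone \<noteq> {}"
  using zero_in_psd_cone by auto

lemma closed_sym_mats: "closed sym_mats"
  using closed_subspace subspace_sym_mats by blast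

lemma bounded_linear_quadratic_form:
  "bounded_linear (\<lambda>A :: real^'n^'n. v \<bullet> (A *v v))"
  unfolding linear_conv_bounded_linear [symmetric]
  by (auto intro!: linearI
      simp: matrix_vector_mult_add_rdistrib scaleR_matrix_vector_assoc [symmetric] inner_add_right)

lemma psd_cone_eq: "psd_cone = sym_mats \<inter> (\<Inter>v. (\<lambda>A. v \<bullet> (A *v v)) -` {0..})"
  by (auto simp: psd_cone_def)

lemma closed_psd_cone: "closed psd_cone"
proof -
  have "closed ((\<lambda>A :: real^'n^'n. v \<bullet> (A *v v)) -` {0..})" for v
    by (rule closed_vimage [OF closed_atLeast
          linear_continuous_on [OF bounded_linear_quadratic_form]])
  then show ?thesis
    unfolding psd_cone_eq by (intro closed_Int closed_sym_mats closed_INT ballI)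
qed

lemma convex_psd_cone: "convex psd_cone"
proof -
  have "convex ((\<lambda>A :: real^'n^'n. v \<bullet> (A *v v)) -` {0..})" for v
    by (rule convex_linear_vimage
        [OF bounded_linear.linear [OF bounded_linear_quadratic_form] convex_real_interval(1)])
  then show ?thesis
    unfolding psd_cone_eq
    by (intro convex_Int subspace_imp_convex [OF subspace_sym_mats] convex_INT)
qed

lemma psd_cone_scaleR: "A \<in> psd_cone \<Longrightarrow> 0 \<le> c \<Longrightarrow> c *\<^sub>R A \<in> psd_cone"
  by (simp add: psd_cone_def sym_mats_def transpose_scalar scaleR_matrix_vector_assoc [symmetric])

lemma psd_cone_add: "A \<in> psd_cone \<Longrightarrow> B \<in> psd_cone \<Longrightarrow> A + B \<in> psd_cone"
  by (simp add: psd_cone_def sym_mats_def transpose_add matrix_vector_mult_add_rdistrib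
      inner_add_right)

lemma psd_cone_congruence:
  assumes "A \<in> psd_cone"
  shows "transpose B ** A ** B \<in> psd_cone"
proof -
  have "v \<bullet> ((transpose B ** A ** B) *v v) = (B *v v) \<bullet> (A *v (B *v v))" for v
    by (simp add: matrix_vector_mul_assoc [symmetric]) (metis dot_lmul_matrix inner_commute)
  then have "0 \<le> v \<bullet> ((transpose B ** A ** B) *v v)" for v
    using assms by (simp only: psd_cone_def mem_Collect_eq)
  moreover have "transpose (transpose B ** A ** B) = transpose B ** A ** B"
    using assms by (simp add: matrix_transpose_mul matrix_mul_assoc psd_cone_transpose)
  ultimately show ?thesis unfolding psd_cone_def sym_mats_def by blast
qed

text \<open>The expression is the trace of \<open>transpose D ** A ** D\<close>, a sum of quadratic
  forms of \<open>A\<close> over the columns of \<open>D\<close>.\<close>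

lemma inner_psd_mult_nonneg:
  assumes "A \<in> psd_cone"
  shows "0 \<le> D \<bullet> (A ** D)"
proof -
  have "D \<bullet> (A ** D) = (\<Sum>j\<in>UNIV. column j D \<bullet> (A *v column j D))"
    unfolding inner_vec_def inner_real_def
    by (subst sum.swap)
      (simp add: matrix_matrix_mult_def matrix_vector_mult_def column_def)
  also have "\<dots> \<ge> 0"
    using assms by (auto intro: sum_nonneg simp: psd_cone_def)
  finally show ?thesis .
qed

text \<open>\<open>D\<close> minimises the nonnegative quadratic form of \<open>A\<close>, so every
  directional derivative there vanishes; the one along \<open>A ** D\<close> is twice the squared
  norm of \<open>A ** D\<close>.\<close>

lemma psd_mult_eq_0:
  assumes A: "A \<in> psd_cone" and 0: "D \<bullet> (A ** D) = 0"
  shows "A ** D = 0"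
proof -
  define E where "E = A ** D"
  have "0 \<le> e * (2 * (E \<bullet> E)) + e\<^sup>2 * (E \<bullet> (A ** E))" for e
  proof -
    have "D \<bullet> (A ** E) = E \<bullet> E"
      using A by (metis E_def inner_mult_left psd_cone_transpose)
    then have "(D + e *\<^sub>R E) \<bullet> (A ** (D + e *\<^sub>R E))
        = e * (2 * (E \<bullet> E)) + e\<^sup>2 * (E \<bullet> (A ** E))"
      using 0 by (simp add: mult_mat_simps inner_add_left inner_add_right E_def [symmetric]
          power2_eq_square algebra_simps)
    then show ?thesis using inner_psd_mult_nonneg [OF A] by metis
  qed
  from quadratic_nonneg_linear_coeff_0 [OF this] show ?thesis
    by (simp add: E_def)
qed

subsection \<open>Complementary splittings\<close>

text \<open>The Moreau decomposition of \<open>X + Y\<close> along the cone and its polar in the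
  symmetric matrices. Under the sign conditions, orthogonality amounts to the matrix equation
  \<open>X ** Y = 0\<close>, which can be linearised and compressed.\<close>

definition psd_split :: "real^'p^'p \<Rightarrow> real^'p^'p \<Rightarrow> bool" where
  "psd_split X Y \<longleftrightarrow> X \<in> psd_cone \<and> - Y \<in> psd_cone \<and> X ** Y = 0"

text \<open>Normality is tested on two families in the cone: congruences of \<open>X\<close>, which
  can be run with either sign of \<open>e\<close> and force \<open>Y ** X = 0\<close>, and rank-one
  additions to \<open>X\<close>, which force the sign of \<open>Y\<close>.\<close>

lemma normal_psd_imp_psd_split:
  assumes "Y \<in> normal_psd X"
  shows "psd_split X Y"
proof -
  have X: "X \<in> psd_cone" and Y: "Y \<in> sym_mats"
    and le: "\<And>A. A \<in> psd_cone \<Longrightarrow> Y \<bullet> (A - X) \<le> 0"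
    using assms by (auto simp: normal_psd_def normal_cone_in_def)
  have "Y ** X = 0"
  proof -
    define B where "B = Y ** X"
    have "0 \<le> e * (- (2 * (B \<bullet> B))) + e\<^sup>2 * (- (Y \<bullet> (B ** X ** transpose B)))" for e
    proof -
      \<comment> \<open>Chosen so that the first-order change of the congruence, paired with
        \<open>Y\<close>, is \<open>2 * (B \<bullet> B)\<close>.\<close>
      define C where "C = mat 1 + e *\<^sub>R transpose B"
      have "transpose C ** X ** C - X
          = e *\<^sub>R (B ** X + X ** transpose B) + e\<^sup>2 *\<^sub>R (B ** X ** transpose B)"
        by (simp add: C_def transpose_mat_simps mult_mat_simps matrix_mul_assoc
            power2_eq_square algebra_simps)
      moreover have "Y \<bullet> (B ** X) = B \<bullet> B" "Y \<bullet> (X ** transpose B) = B \<bullet> B"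
      proof -
        show 1: "Y \<bullet> (B ** X) = B \<bullet> B"
          using X by (metis B_def inner_commute inner_mult_right psd_cone_transpose)
        have "Y \<bullet> (X ** transpose B) = transpose Y \<bullet> transpose (X ** transpose B)"
          by (rule inner_transpose [symmetric])
        also have "\<dots> = Y \<bullet> (B ** X)"
          using X Y by (simp add: matrix_transpose_mul psd_cone_transpose sym_mats_transpose)
        finally show "Y \<bullet> (X ** transpose B) = B \<bullet> B" using 1 by simp
      qed
      ultimately have "Y \<bullet> (transpose C ** X ** C - X)
          = e * (2 * (B \<bullet> B)) + e\<^sup>2 * (Y \<bullet> (B ** X ** transpose B))"
        by (simp add: inner_add_right)
      with le [OF psd_cone_congruence [OF X], of C] show ?thesis by simp
    qed
    from quadratic_nonneg_linear_coeff_0 [OF this] show ?thesis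
      by (simp add: B_def)
  qed
  then have XY: "X ** Y = 0"
    using X Y
    by (metis matrix_transpose_mul psd_cone_transpose sym_mats_transpose transpose_zero)
  have "v \<bullet> (Y *v v) \<le> 0" for v
  proof -
    \<comment> \<open>The rank-one matrix of \<open>v\<close>: pairing it with \<open>Y\<close>
      gives the quadratic form of \<open>Y\<close> at \<open>v\<close>.\<close>
    define R :: "real^'a^'a" where "R = (\<chi> i j. v $ i * v $ j)"
    have "w \<bullet> (R *v w) = (v \<bullet> w)\<^sup>2" for w
      by (simp add: R_def inner_vec_def matrix_vector_mult_def power2_eq_square
          sum_distrib_left sum_distrib_right mult_ac)
    then have "R \<in> psd_cone"
      by (auto simp: psd_cone_def sym_mats_def R_def transpose_def vec_eq_iff mult.commute)
    then have "Y \<bullet> R \<le> 0"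
      using le [OF psd_cone_add [OF X]] by fastforce
    also have "Y \<bullet> R = v \<bullet> (Y *v v)"
      by (simp add: R_def inner_vec_def matrix_vector_mult_def sum_distrib_left mult_ac)
    finally show ?thesis .
  qed
  moreover have "v \<bullet> (- Y *v v) = - (v \<bullet> (Y *v v))" for v
    using scaleR_matrix_vector_assoc [of "- 1" Y v, symmetric] by simp
  ultimately have "- Y \<in> psd_cone"
    using Y by (simp add: psd_cone_def sym_mats_def transpose_mat_simps)
  with X XY show ?thesis by (simp add: psd_split_def)
qed

text \<open>With \<open>D = A - A'\<close>, the two complementarity relations express \<open>tr D\<^sup>3\<close> both as a
  nonnegative and as a nonpositive quantity.\<close>

lemma psd_split_unique:
  assumes "psd_split A C" "psd_split A' C'" and sum: "A + C = A' + C'"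
  shows "A = A'"
proof -
  have psd: "A \<in> psd_cone" "- C \<in> psd_cone" "A' \<in> psd_cone" "- C' \<in> psd_cone"
    and z: "A ** C = 0" "A' ** C' = 0"
    using assms by (auto simp: psd_split_def)
  define D where "D = A - A'"
  have C': "C' = C + D" and A': "A' = A - D"
    using sum by (auto simp: D_def algebra_simps)
  have tD: "transpose D = D"
    using psd by (simp add: D_def transpose_diff psd_cone_transpose)
  have tC: "transpose C = C" "transpose C' = C'"
    using psd by (simp_all add: neg_psd_cone_transpose)
  \<comment> \<open>Pairing with the symmetric \<open>D\<close> does not see transposition, which
    exchanges the two products.\<close>
  have swap: "D \<bullet> (D ** E) = D \<bullet> (E ** D)" if "transpose E = E" for E
    by (metis inner_transpose matrix_transpose_mul tD that)
  have "A ** D - D ** C - D ** D = 0"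
    using z by (simp add: C' A' mult_mat_simps algebra_simps)
  then have DD: "D ** D = A ** D - D ** C" by simp
  then have eq1: "D \<bullet> (D ** D) = D \<bullet> (A ** D) + D \<bullet> (- C ** D)"
    by (simp add: inner_diff_right swap tC mult_mat_simps)
  have "D ** D = D ** C' - A' ** D"
    using DD by (simp add: C' A' mult_mat_simps algebra_simps)
  then have eq2: "D \<bullet> (D ** D) = - (D \<bullet> (A' ** D) + D \<bullet> (- C' ** D))"
    by (simp add: inner_diff_right swap tC mult_mat_simps)
  have "D \<bullet> (A ** D) = 0 \<and> D \<bullet> (- C ** D) = 0"
    using eq1 eq2 psd [THEN inner_psd_mult_nonneg, of D] by linarith
  then have AD: "A ** D = 0" and "- C ** D = 0"
    using psd_mult_eq_0 psd by blast+
  then have "D ** C = 0"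
    by (metis tC(1) tD matrix_transpose_mul transpose_zero mult_mat_simps(5)
        neg_equal_0_iff_equal)
  with AD DD have "D ** D = 0" by simp
  then have "D = 0" using transpose_mult_self_eq_0 tD by metis
  then show ?thesis by (simp add: D_def)
qed

text \<open>Multiplying by \<open>X\<close> removes the \<open>Y\<close> part because
  \<open>X ** Y = 0\<close>, leaving \<open>X ** (X ** P) = 0\<close>, where one factor of the
  symmetric \<open>X\<close> cancels. So the kernel of \<open>X + Y\<close> is the common
  kernel.\<close>

lemma psd_split_kernel:
  assumes "psd_split X Y" and ZP: "(X + Y) ** P = 0"
  shows "X ** P = 0" "Y ** P = 0"
proof -
  have X: "X \<in> psd_cone" and XY: "X ** Y = 0"
    using assms by (auto simp: psd_split_def)
  have "X ** (X ** P) = 0"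
    using ZP XY by (metis add.right_neutral matrix_mul_assoc mult_mat_simps(2,10))
  then have "transpose (X ** P) ** (X ** P) = 0"
    using X
    by (simp add: psd_cone_transpose matrix_transpose_mul matrix_mul_assoc [symmetric] mult_mat_simps)
  then show XP: "X ** P = 0" by (rule transpose_mult_self_eq_0)
  then show "Y ** P = 0" using ZP by (simp add: mult_mat_simps)
qed

text \<open>The system satisfied by every limit \<open>(W, V)\<close> of difference quotients of the splitting map
  \<open>Z \<mapsto> (X, Y)\<close> at \<open>Z = X + Y\<close>; in an eigenbasis of \<open>Z\<close>, the last conjunct constrains the block
  belonging to the eigenvalue \<open>0\<close>.\<close>

definition split_tangent ::
    "real^'p^'p \<Rightarrow> real^'p^'p \<Rightarrow> real^'p^'p \<Rightarrow> real^'p^'p \<Rightarrow> bool" where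
  "split_tangent X Y W V \<longleftrightarrow> W \<in> sym_mats \<and> V \<in> sym_mats \<and> X ** V + W ** Y = 0 \<and>
    (\<forall>P :: real^'p^'p. (X + Y) ** P = 0 \<longrightarrow>
      transpose P ** W ** P \<in> psd_cone \<and> - (transpose P ** V ** P) \<in> psd_cone \<and>
      transpose P ** (W ** V) ** P = 0)"

text \<open>Dividing the perturbed complementarity equation by \<open>t k\<close> leaves the linear
  terms plus a multiple of \<open>t k\<close> that vanishes in the limit. Compressed to the common
  kernel of \<open>X\<close> and \<open>Y\<close>, the linear terms disappear, and a second division
  by \<open>t k\<close> preserves the quadratic information.\<close>

lemma split_tangent_limit:
  fixes W V :: "nat \<Rightarrow> real^'p^'p"
  assumes XY: "psd_split X Y"
    and split: "\<And>k. psd_split (X + t k *\<^sub>R W k) (Y + t k *\<^sub>R V k)"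
    and t: "\<And>k. 0 < t k" "t \<longlonglongrightarrow> 0"
    and lim: "W \<longlonglongrightarrow> w" "V \<longlonglongrightarrow> v"
  shows "split_tangent X Y w v"
proof -
  have X: "X \<in> psd_cone" and Y: "- Y \<in> psd_cone" and XY0: "X ** Y = 0"
    using XY by (auto simp: psd_split_def)
  have tX: "transpose X = X" and tY: "transpose Y = Y"
    using X Y by (simp_all add: psd_cone_transpose neg_psd_cone_transpose)
  have Xk: "X + t k *\<^sub>R W k \<in> psd_cone" and Yk: "- (Y + t k *\<^sub>R V k) \<in> psd_cone"
    and XYk: "(X + t k *\<^sub>R W k) ** (Y + t k *\<^sub>R V k) = 0" for k
    using split [of k] by (auto simp: psd_split_def)
  have Ws: "W k \<in> sym_mats" for k
    using psd_cone_transpose [OF Xk [of k]] t(1) [of k]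
    by (simp add: sym_mats_def transpose_mat_simps tX)
  have Vs: "V k \<in> sym_mats" for k
    using neg_psd_cone_transpose [OF Yk [of k]] t(1) [of k]
    by (simp add: sym_mats_def transpose_mat_simps tY)
  have first: "X ** V k + W k ** Y + t k *\<^sub>R (W k ** V k) = 0" for k
  proof -
    have "t k *\<^sub>R (X ** V k + W k ** Y + t k *\<^sub>R (W k ** V k)) = 0"
      using XYk [of k] by (simp add: mult_mat_simps XY0 scaleR_add_right add_ac)
    then show ?thesis using t(1) [of k] by simp
  qed
  have "(\<lambda>k. X ** V k + W k ** Y + t k *\<^sub>R (W k ** V k)) \<longlonglongrightarrow> X ** v + w ** Y + 0 *\<^sub>R (w ** v)"
    by (intro tendsto_intros tendsto_mat_mult t lim)
  then have eq: "X ** v + w ** Y = 0"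
    by (simp add: first LIMSEQ_const_iff)
  have "transpose P ** w ** P \<in> psd_cone \<and> - (transpose P ** v ** P) \<in> psd_cone \<and>
      transpose P ** (w ** v) ** P = 0" if ZP: "(X + Y) ** P = 0" for P :: "real^'p^'p"
  proof (intro conjI)
    note P = psd_split_kernel [OF XY ZP]
    have PX: "transpose P ** X = 0"
      using P(1) by (metis tX matrix_transpose_mul transpose_zero)
    have "transpose P ** W k ** P \<in> psd_cone" for k
    proof -
      have "transpose P ** (X + t k *\<^sub>R W k) ** P = t k *\<^sub>R (transpose P ** W k ** P)"
        by (simp add: mult_mat_simps PX)
      then have "inverse (t k) *\<^sub>R t k *\<^sub>R (transpose P ** W k ** P) \<in> psd_cone"
        using psd_cone_scaleR [OF psd_cone_congruence [OF Xk [of k]], of "inverse (t k)" P] t(1) [of k]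
        by simp
      then show ?thesis using t(1) [of k] by simp
    qed
    moreover have "(\<lambda>k. transpose P ** W k ** P) \<longlonglongrightarrow> transpose P ** w ** P"
      by (intro tendsto_intros tendsto_mat_mult lim)
    ultimately show "transpose P ** w ** P \<in> psd_cone"
      by (rule closed_sequentially [OF closed_psd_cone])
    have "- (transpose P ** V k ** P) \<in> psd_cone" for k
    proof -
      have "transpose P ** - (Y + t k *\<^sub>R V k) ** P = t k *\<^sub>R - (transpose P ** V k ** P)"
        by (simp add: mult_mat_simps P(2) matrix_mul_assoc [symmetric])
      then have "inverse (t k) *\<^sub>R t k *\<^sub>R - (transpose P ** V k ** P) \<in> psd_cone"
        using psd_cone_scaleR [OF psd_cone_congruence [OF Yk [of k]], of "inverse (t k)" P] t(1) [of k]
        by simp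
      then show ?thesis using t(1) [of k] by simp
    qed
    moreover have "(\<lambda>k. - (transpose P ** V k ** P)) \<longlonglongrightarrow> - (transpose P ** v ** P)"
      by (intro tendsto_intros tendsto_mat_mult lim)
    ultimately show "- (transpose P ** v ** P) \<in> psd_cone"
      by (rule closed_sequentially [OF closed_psd_cone])
    \<comment> \<open>Sandwiching \<open>first\<close> removes \<open>X\<close> on the left and
      \<open>Y\<close> on the right, so only the product \<open>W k ** V k\<close> remains.\<close>
    have "transpose P ** (W k ** V k) ** P = 0" for k
    proof -
      have "transpose P ** (X ** V k + W k ** Y + t k *\<^sub>R (W k ** V k)) ** P
          = (transpose P ** X) ** V k ** P + transpose P ** W k ** (Y ** P)
            + t k *\<^sub>R (transpose P ** (W k ** V k) ** P)"
        by (simp add: mult_mat_simps matrix_mul_assoc)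
      then show ?thesis
        using t(1) [of k] by (simp add: first PX P(2) mult_mat_simps)
    qed
    moreover have "(\<lambda>k. transpose P ** (W k ** V k) ** P) \<longlonglongrightarrow> transpose P ** (w ** v) ** P"
      by (intro tendsto_intros tendsto_mat_mult lim)
    ultimately show "transpose P ** (w ** v) ** P = 0"
      by (simp add: LIMSEQ_const_iff)
  qed
  moreover have "w \<in> sym_mats" "v \<in> sym_mats"
    by (rule closed_sequentially [OF closed_sym_mats Ws lim(1)],
        rule closed_sequentially [OF closed_sym_mats Vs lim(2)])
  ultimately show ?thesis using eq by (simp add: split_tangent_def)
qed

text \<open>The off-diagonal part \<open>B\<close> of \<open>W P\<close> has its range in that of \<open>X\<close>, while the off-diagonal
  part \<open>B'\<close> of \<open>V P\<close> has its range in the kernel of \<open>X\<close>; hence they do not contribute to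
  \<open>P W V P\<close>.\<close>

lemma split_tangent_kernel_split:
  assumes XY: "psd_split X Y" and T: "split_tangent X Y W V"
    and P: "P \<in> sym_mats" "P ** P = P" "(X + Y) ** P = 0" "mat 1 = P + (X + Y) ** K"
  shows "psd_split (P ** W ** P) (P ** V ** P)"
proof -
  have X: "X \<in> psd_cone" and Y: "- Y \<in> psd_cone" and XY0: "X ** Y = 0"
    using XY by (auto simp: psd_split_def)
  have tX: "transpose X = X" and tY: "transpose Y = Y"
    using X Y by (simp_all add: psd_cone_transpose neg_psd_cone_transpose)
  have YX0: "Y ** X = 0"
    using XY0 by (metis tX tY matrix_transpose_mul transpose_zero)
  note kP = psd_split_kernel [OF XY P(3)]
  have tP: "transpose P = P" using P(1) by (rule sym_mats_transpose)
  have PX: "P ** X = 0"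
    using kP(1) by (metis tP tX matrix_transpose_mul transpose_zero)
  have W: "transpose W = W" and V: "transpose V = V" and eq: "X ** V + W ** Y = 0"
    and ker: "P ** W ** P \<in> psd_cone" "- (P ** V ** P) \<in> psd_cone" "P ** (W ** V) ** P = 0"
    using T P(3) tP by (auto simp: split_tangent_def sym_mats_transpose)
  have "transpose (X ** V + W ** Y) = 0" by (simp add: eq transpose_mat_simps)
  then have eq': "V ** X + Y ** W = 0"
    by (simp add: transpose_add matrix_transpose_mul W V tX tY)
  have XVP: "X ** V ** P = 0"
  proof -
    have "X ** V ** P + W ** (Y ** P) = (X ** V + W ** Y) ** P"
      by (simp add: mult_mat_simps matrix_mul_assoc)
    then show ?thesis by (simp add: eq kP(2) mult_mat_simps)
  qed
  have YWP: "Y ** W ** P = 0"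
  proof -
    have "V ** (X ** P) + Y ** W ** P = (V ** X + Y ** W) ** P"
      by (simp add: mult_mat_simps matrix_mul_assoc)
    then show ?thesis by (simp add: eq' kP(1) mult_mat_simps)
  qed
  define B where "B = W ** P - P ** W ** P"
  define B' where "B' = V ** P - P ** V ** P"
  define S where "S = K ** W ** P"
  have "W ** P = mat 1 ** (W ** P)" by simp
  also have "\<dots> = P ** W ** P + (X + Y) ** S"
    by (subst P(4)) (simp add: S_def mult_mat_simps matrix_mul_assoc)
  finally have B: "B = (X + Y) ** S" by (simp add: B_def)
  \<comment> \<open>So far \<open>B\<close> is only known to lie in the range of
    \<open>X + Y\<close>. Since \<open>Y ** X = 0\<close>, applying \<open>Y\<close> isolates
    \<open>Y ** (Y ** S)\<close>; its vanishing kills \<open>Y ** S\<close> and leaves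
    \<open>B = X ** S\<close>.\<close>
  have YB: "Y ** B = 0"
    by (simp add: B_def mult_mat_simps matrix_mul_assoc YWP kP(2))
  then have "Y ** (Y ** S) = 0"
    by (simp add: B mult_mat_simps matrix_mul_assoc YX0)
  then have "transpose (Y ** S) ** (Y ** S) = 0"
    by (simp add: matrix_transpose_mul tY matrix_mul_assoc [symmetric] mult_mat_simps)
  then have "Y ** S = 0" by (rule transpose_mult_self_eq_0)
  then have BX: "B = X ** S" by (simp add: B mult_mat_simps)
  have XB': "X ** B' = 0"
    by (simp add: B'_def mult_mat_simps matrix_mul_assoc XVP kP(1))
  have BB': "transpose B ** B' = 0"
    using XB' by (simp add: BX tX matrix_transpose_mul matrix_mul_assoc [symmetric] mult_mat_simps)
  have PB': "P ** B' = 0"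
    by (simp add: B'_def mult_mat_simps matrix_mul_assoc P(2))
  have BP: "transpose B ** P = 0"
    using PX by (simp add: BX tX tP matrix_transpose_mul matrix_mul_assoc [symmetric] kP(1) mult_mat_simps)
  have "P ** (W ** V) ** P = transpose (W ** P) ** (V ** P)"
    by (simp add: tP matrix_transpose_mul W matrix_mul_assoc)
  also have "\<dots> = transpose (P ** W ** P + B) ** (P ** V ** P + B')"
    by (simp add: B_def B'_def)
  also have "\<dots> = (P ** W ** P) ** (P ** V ** P) + P ** W ** (P ** B')
      + (transpose B ** P) ** V ** P + transpose B ** B'"
    by (simp add: tP transpose_add matrix_transpose_mul W mult_mat_simps
        matrix_mul_assoc)
  also have "\<dots> = (P ** W ** P) ** (P ** V ** P)"
    by (simp add: PB' BP BB' mult_mat_simps)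
  finally show ?thesis using ker by (simp add: psd_split_def)
qed

text \<open>The linear relations give \<open>X ** D = D ** Y\<close>; pairing with \<open>D\<close>
  makes a nonnegative number equal a nonpositive one, so \<open>X\<close> and \<open>Y\<close> both
  annihilate \<open>D\<close>. What is left is the compression of \<open>D\<close> to the kernel of
  \<open>X + Y\<close>, where \<open>psd_split_unique\<close> applies.\<close>

lemma split_tangent_unique:
  assumes XY: "psd_split X Y" and T: "split_tangent X Y W V" "split_tangent X Y W' V'"
    and sum: "W + V = W' + V'"
  shows "W = W'"
proof -
  have X: "X \<in> psd_cone" and Y: "- Y \<in> psd_cone"
    using XY by (auto simp: psd_split_def)
  have tX: "transpose X = X" and tY: "transpose Y = Y"
    using X Y by (simp_all add: psd_cone_transpose neg_psd_cone_transpose)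
  define D where "D = W - W'"
  have V': "V' = V + D" using sum by (simp add: D_def algebra_simps)
  have tD: "transpose D = D"
    using T by (simp add: D_def split_tangent_def transpose_diff sym_mats_transpose)
  have "X ** V + W ** Y = 0" "X ** V' + W' ** Y = 0"
    using T by (auto simp: split_tangent_def)
  then have "X ** V = - (W ** Y)" "X ** V' = - (W' ** Y)"
    by (simp_all add: eq_neg_iff_add_eq_0)
  moreover have "X ** D = X ** V' - X ** V"
    by (simp add: V' mult_mat_simps)
  ultimately have XD: "X ** D = D ** Y"
    by (simp add: D_def mult_mat_simps)
  have "D \<bullet> (D ** Y) = D \<bullet> (Y ** D)"
    by (metis inner_transpose matrix_transpose_mul tD tY)
  then have "D \<bullet> (X ** D) = - (D \<bullet> (- Y ** D))"
    by (simp add: XD mult_mat_simps)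
  then have "D \<bullet> (X ** D) = 0"
    using inner_psd_mult_nonneg [OF X, of D] inner_psd_mult_nonneg [OF Y, of D] by linarith
  then have XD0: "X ** D = 0" by (rule psd_mult_eq_0 [OF X])
  then have YD0: "Y ** D = 0"
    by (metis XD matrix_transpose_mul tD tY transpose_zero)
  have "X + Y \<in> sym_mats"
    using tX tY by (simp add: sym_mats_def transpose_add)
  then obtain P K where P: "P \<in> sym_mats" "P ** P = P" "(X + Y) ** P = 0" "mat 1 = P + (X + Y) ** K"
    by (rule ker_projection)
  \<comment> \<open>Passing between the two solutions shifts \<open>W\<close> and \<open>V\<close>
    by opposite multiples of \<open>D\<close>, so the compressed pairs have the same sum.\<close>
  have "P ** V ** P = P ** V' ** P - P ** D ** P" by (simp add: V' mult_mat_simps)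
  moreover have "P ** W ** P = P ** W' ** P + P ** D ** P" by (simp add: D_def mult_mat_simps)
  ultimately have "P ** W ** P + P ** V ** P = P ** W' ** P + P ** V' ** P" by simp
  with psd_split_unique split_tangent_kernel_split [OF XY T(1) P]
    split_tangent_kernel_split [OF XY T(2) P]
  have eq: "P ** W ** P = P ** W' ** P" by blast
  have DY: "D ** Y = 0" by (metis XD XD0)
  have DX: "D ** X = 0" by (metis XD0 matrix_transpose_mul tD tX transpose_zero)
  \<comment> \<open>Inserting the decomposition of \<open>mat 1\<close> shows that \<open>D\<close>
    is unchanged by \<open>P\<close> on the right, and by symmetry on the left.\<close>
  have "D = D ** mat 1" by simp
  also have "\<dots> = D ** P"
    by (subst P(4)) (simp add: mult_mat_simps matrix_mul_assoc DX DY)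
  finally have DP: "D = D ** P" .
  then have PD: "D = P ** D"
    using P(1) tD by (metis matrix_transpose_mul sym_mats_transpose)
  have "D = P ** D ** P" using DP PD by metis
  also have "\<dots> = 0" using eq by (simp add: D_def mult_mat_simps)
  finally show ?thesis by (simp add: D_def)
qed

subsection \<open>Directional differentiability of the projection\<close>

text \<open>Compactness: a sequence staying away from the candidate limit would have a subsequence
  with a second cluster point.\<close>

lemma tendsto_at_right_unique_cluster:
  fixes F :: "real \<Rightarrow> 'a::heine_borel"
  assumes bdd: "bounded (F ` {0<..})"
    and uniq: "\<And>s s' w w'. (\<And>k :: nat. 0 < s k) \<Longrightarrow> s \<longlonglongrightarrow> 0 \<Longrightarrow> (\<lambda>k. F (s k)) \<longlonglongrightarrow> w \<Longrightarrow>
      (\<And>k :: nat. 0 < s' k) \<Longrightarrow> s' \<longlonglongrightarrow> 0 \<Longrightarrow> (\<lambda>k. F (s' k)) \<longlonglongrightarrow> w' \<Longrightarrow> w = w'"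
  obtains w where "(F \<longlongrightarrow> w) (at_right 0)"
proof -
  have cluster: "\<exists>r w. strict_mono r \<and> (\<lambda>k. F (s (r k))) \<longlonglongrightarrow> w" if "\<And>k :: nat. 0 < s k" for s
  proof -
    have "range (\<lambda>k. F (s k)) \<subseteq> F ` {0<..}" using that by auto
    then have "bounded (range (\<lambda>k. F (s k)))" using bdd bounded_subset by blast
    then show ?thesis
      using bounded_imp_convergent_subsequence [of "\<lambda>k. F (s k)"] by (auto simp: o_def)
  qed
  obtain r w where r: "strict_mono r" and w: "(\<lambda>k. F (inverse (real (Suc (r k))))) \<longlonglongrightarrow> w"
    using cluster [of "\<lambda>k. inverse (real (Suc k))"] by auto
  have lim0: "(\<lambda>k. inverse (real (Suc (r k)))) \<longlonglongrightarrow> 0"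
    using LIMSEQ_subseq_LIMSEQ [OF LIMSEQ_inverse_real_of_nat r] by (simp add: o_def)
  have "(F \<longlongrightarrow> w) (at_right 0)"
  proof (rule ccontr)
    assume "\<not> ?thesis"
    then obtain e where e: "e > 0" and "\<not> eventually (\<lambda>t. dist (F t) w < e) (at_right 0)"
      by (auto simp: tendsto_iff)
    then have ex: "\<exists>t>0. t < d \<and> \<not> dist (F t) w < e" if "d > 0" for d
      using that by (fastforce simp: eventually_at_right_field)
    have "\<exists>t>0. t < inverse (real (Suc k)) \<and> \<not> dist (F t) w < e" for k
      by (rule ex) simp
    then obtain s where s: "\<And>k. 0 < s k" "\<And>k. s k < inverse (real (Suc k))"
      "\<And>k. \<not> dist (F (s k)) w < e"
      by metis
    have "s \<longlonglongrightarrow> 0"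
    proof (rule tendsto_sandwich [OF _ _ tendsto_const LIMSEQ_inverse_real_of_nat])
      show "\<forall>\<^sub>F k in sequentially. 0 \<le> s k"
        using s(1) by (intro always_eventually allI less_imp_le)
      show "\<forall>\<^sub>F k in sequentially. s k \<le> inverse (real (Suc k))"
        using s(2) by (intro always_eventually allI less_imp_le)
    qed
    obtain q w' where q: "strict_mono q" and w': "(\<lambda>k. F (s (q k))) \<longlonglongrightarrow> w'"
      using cluster [of s] s(1) by auto
    have "(\<lambda>k. s (q k)) \<longlonglongrightarrow> 0"
      using LIMSEQ_subseq_LIMSEQ [OF \<open>s \<longlonglongrightarrow> 0\<close> q] by (simp add: o_def)
    then have "w = w'"
      using w' by (intro uniq [OF _ lim0 w]) (simp_all add: s)
    with w' e have "eventually (\<lambda>k. dist (F (s (q k))) w < e) sequentially"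
      by (auto simp: tendsto_iff)
    then show False using s(3) by simp
  qed
  then show ?thesis by (rule that)
qed

text \<open>Expanding the squared distance from \<open>X + Y\<close> to \<open>A\<close> turns the
  normal inequality into minimality of \<open>X\<close>. Symmetry of \<open>Y\<close> is stated
  separately because the projection in the ambient matrix space ignores skew parts.\<close>

lemma normal_psd_iff_closest_point:
  "Y \<in> normal_psd X \<longleftrightarrow> Y \<in> sym_mats \<and> X = closest_point psd_cone (X + Y)"
proof
  assume Y: "Y \<in> normal_psd X"
  then have X: "X \<in> psd_cone" and le: "\<And>A. A \<in> psd_cone \<Longrightarrow> Y \<bullet> (A - X) \<le> 0"
    by (auto simp: normal_psd_def normal_cone_in_def)
  have "dist (X + Y) X \<le> dist (X + Y) A" if "A \<in> psd_cone" for A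
  proof -
    have "(X + Y - A) \<bullet> (X + Y - A) = Y \<bullet> Y - 2 * (Y \<bullet> (A - X)) + (A - X) \<bullet> (A - X)"
      by (simp add: algebra_simps inner_commute)
    then have "Y \<bullet> Y \<le> (X + Y - A) \<bullet> (X + Y - A)"
      using le [OF that] by (smt (verit) inner_ge_zero)
    then show ?thesis by (simp add: dist_norm norm_le)
  qed
  then have "X = closest_point psd_cone (X + Y)"
    by (intro closest_point_unique convex_psd_cone closed_psd_cone X ballI)
  with Y show "Y \<in> sym_mats \<and> X = closest_point psd_cone (X + Y)"
    by (simp add: normal_psd_def normal_cone_in_def)
next
  assume Y: "Y \<in> sym_mats \<and> X = closest_point psd_cone (X + Y)"
  then have "X \<in> psd_cone"
    by (metis closest_point_in_set closed_psd_cone psd_cone_nonempty)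
  moreover have "Y \<bullet> (A - X) \<le> 0" if "A \<in> psd_cone" for A
    using closest_point_dot [OF convex_psd_cone closed_psd_cone that, of "X + Y"] Y by simp
  ultimately show "Y \<in> normal_psd X"
    using Y by (simp add: normal_psd_def normal_cone_in_def)
qed

lemma closest_point_psd_in_sym: "closest_point psd_cone Z \<in> sym_mats"
  by (simp add: psd_cone_sym closest_point_in_set closed_psd_cone psd_cone_nonempty)

lemma psd_split_closest_point:
  assumes "Z \<in> sym_mats"
  shows "psd_split (closest_point psd_cone Z) (Z - closest_point psd_cone Z)"
  using assms
  by (intro normal_psd_imp_psd_split)
    (simp add: normal_psd_iff_closest_point subspace_diff subspace_sym_mats closest_point_psd_in_sym)

text \<open>\<open>directional_derivative\<close> is a \<open>Lim\<close>, informative only when the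
  limit exists; its existence is the content here.\<close>

lemma closest_point_psd_directional_derivative:
  fixes Z H :: "real^'p^'p"
  assumes Z: "Z \<in> sym_mats" and H: "H \<in> sym_mats"
  shows "((\<lambda>t. (closest_point psd_cone (Z + t *\<^sub>R H) - closest_point psd_cone Z) /\<^sub>R t)
    \<longlongrightarrow> directional_derivative (closest_point psd_cone) Z H) (at_right 0)"
proof -
  define p :: "real^'p^'p \<Rightarrow> real^'p^'p" where "p = closest_point psd_cone"
  define F where "F t = (p (Z + t *\<^sub>R H) - p Z) /\<^sub>R t" for t :: real
  have "norm (F t) \<le> norm H" if "t > 0" for t
  proof -
    have "dist (p (Z + t *\<^sub>R H)) (p Z) \<le> dist (Z + t *\<^sub>R H) Z"
      unfolding p_def by (rule closest_point_lipschitz [OF convex_psd_cone closed_psd_cone psd_cone_nonempty])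
    then have "norm (p (Z + t *\<^sub>R H) - p Z) \<le> t * norm H"
      using that by (simp add: dist_norm)
    moreover have "norm (F t) = norm (p (Z + t *\<^sub>R H) - p Z) / t"
      using that by (simp add: F_def divide_inverse mult.commute)
    ultimately show ?thesis
      using that by (simp only: pos_divide_le_eq mult.commute)
  qed
  then have bdd: "bounded (F ` {0<..})"
    by (auto simp: bounded_iff)
  have XY: "psd_split (p Z) (Z - p Z)"
    unfolding p_def by (rule psd_split_closest_point [OF Z])
  \<comment> \<open>\<open>F (s k)\<close> and \<open>H - F (s k)\<close> are the difference
    quotients of the two components of the splitting. Every cluster pair sums to \<open>H\<close>,
    as \<open>split_tangent_unique\<close> requires.\<close>
  have tangent: "split_tangent (p Z) (Z - p Z) w (H - w)"
    if s: "\<And>k :: nat. 0 < s k" "s \<longlonglongrightarrow> 0" "(\<lambda>k. F (s k)) \<longlonglongrightarrow> w" for s w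
  proof (rule split_tangent_limit [OF XY _ s])
    show "(\<lambda>k. H - F (s k)) \<longlonglongrightarrow> H - w" by (intro tendsto_intros s)
    show "psd_split (p Z + s k *\<^sub>R F (s k)) (Z - p Z + s k *\<^sub>R (H - F (s k)))" for k
    proof -
      have "Z + s k *\<^sub>R H \<in> sym_mats"
        by (intro subspace_add subspace_scale subspace_sym_mats Z H)
      moreover have "p Z + s k *\<^sub>R F (s k) = p (Z + s k *\<^sub>R H)"
        using s(1) [of k] by (simp add: F_def)
      moreover from this have "Z - p Z + s k *\<^sub>R (H - F (s k)) = Z + s k *\<^sub>R H - p (Z + s k *\<^sub>R H)"
        by (simp add: scaleR_diff_right algebra_simps)
      ultimately show ?thesis
        unfolding p_def by (metis psd_split_closest_point)
    qed
  qed
  obtain w where w: "(F \<longlongrightarrow> w) (at_right 0)"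
  proof (rule tendsto_at_right_unique_cluster [OF bdd])
    fix s s' :: "nat \<Rightarrow> real" and w w'
    assume "\<And>k. 0 < s k" "s \<longlonglongrightarrow> 0" "(\<lambda>k. F (s k)) \<longlonglongrightarrow> w"
      and "\<And>k. 0 < s' k" "s' \<longlonglongrightarrow> 0" "(\<lambda>k. F (s' k)) \<longlonglongrightarrow> w'"
    then have "split_tangent (p Z) (Z - p Z) w (H - w)" "split_tangent (p Z) (Z - p Z) w' (H - w')"
      using tangent by blast+
    then show "w = w'" by (rule split_tangent_unique [OF XY]) simp
  qed
  moreover have "directional_derivative (closest_point psd_cone) Z H = w"
    unfolding directional_derivative_def
    using tendsto_Lim [OF _ w] by (simp add: F_def [abs_def] p_def)
  ultimately show ?thesis by (simp add: F_def [abs_def] p_def)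
qed

subsection \<open>The graphical derivative of the normal cone mapping\<close>

text \<open>A graph point \<open>(x, y)\<close> is recovered from \<open>x + y\<close> by
  projecting, so a tangent pair \<open>(H, E)\<close> corresponds to the direction
  \<open>H + E\<close> at \<open>X + Y\<close>.\<close>

lemma graphical_derivative_normal_psd_iff:
  fixes X Y H E :: "real^'p^'p"
  assumes Y: "Y \<in> normal_psd X" and H: "H \<in> sym_mats"
  shows "E \<in> graphical_derivative normal_psd X Y H \<longleftrightarrow>
    E \<in> sym_mats \<and> H = directional_derivative (closest_point psd_cone) (X + Y) (H + E)"
proof -
  define p :: "real^'p^'p \<Rightarrow> real^'p^'p" where "p = closest_point psd_cone"
  have Ys: "Y \<in> sym_mats" and Xp: "X = p (X + Y)"
    using Y unfolding normal_psd_iff_closest_point p_def by auto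
  have Xs: "X \<in> sym_mats" by (subst Xp) (simp add: p_def closest_point_psd_in_sym)
  have deriv: "((\<lambda>t. (p (X + Y + t *\<^sub>R (H + E)) - X) /\<^sub>R t)
      \<longlongrightarrow> directional_derivative p (X + Y) (H + E)) (at_right 0)" if "E \<in> sym_mats"
    using closest_point_psd_directional_derivative [of "X + Y" "H + E"]
      subspace_add [OF subspace_sym_mats Xs Ys] subspace_add [OF subspace_sym_mats H that]
    unfolding p_def [symmetric] Xp [symmetric] by blast
  have at_right: "filterlim t (at_right 0) sequentially"
    if "\<And>k. 0 < t k" "t \<longlonglongrightarrow> 0" for t :: "nat \<Rightarrow> real"
    using that by (simp add: filterlim_at order_less_imp_not_eq2)
  show ?thesis
  proof
    assume "E \<in> graphical_derivative normal_psd X Y H"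
    then obtain t U where t: "\<And>k. 0 < t k" "t \<longlonglongrightarrow> 0" and U: "U \<longlonglongrightarrow> (H, E)"
      and mem: "\<And>k. U k \<in> (\<lambda>u. (u - (X, Y)) /\<^sub>R t k) ` gph normal_psd"
      by (auto simp: graphical_derivative_def tangent_cone_def)
    define A where "A k = fst (U k)" for k
    define B where "B k = snd (U k)" for k
    have A: "A \<longlonglongrightarrow> H" and B: "B \<longlonglongrightarrow> E"
      using tendsto_fst [OF U] tendsto_snd [OF U] by (simp_all add: A_def [abs_def] B_def [abs_def])
    have gr: "Y + t k *\<^sub>R B k \<in> normal_psd (X + t k *\<^sub>R A k)" for k
    proof -
      obtain x y where "y \<in> normal_psd x" "U k = ((x - X) /\<^sub>R t k, (y - Y) /\<^sub>R t k)"
        using mem [of k] by (auto simp: gph_def)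
      then show ?thesis using t(1) [of k] by (simp add: A_def B_def)
    qed
    have Bs: "B k \<in> sym_mats" for k
    proof -
      have "Y + t k *\<^sub>R B k \<in> sym_mats"
        using gr [of k] by (simp add: normal_psd_iff_closest_point)
      then show ?thesis using Ys t(1) [of k] by (simp add: sym_mats_def transpose_mat_simps)
    qed
    then have Es: "E \<in> sym_mats"
      by (rule closed_sequentially [OF closed_sym_mats]) (rule B)
    have "(\<lambda>k. (p (X + Y + t k *\<^sub>R (H + E)) - X) /\<^sub>R t k)
        \<longlonglongrightarrow> directional_derivative p (X + Y) (H + E)"
      using filterlim_compose [OF deriv [OF Es] at_right [OF t]] .
    \<comment> \<open>The tangent sequence moves along varying directions \<open>A k + B k\<close>.
      Nonexpansiveness bounds the error of freezing the direction at its limit \<open>H + E\<close>,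
      so the derivative along a fixed direction suffices.\<close>
    moreover have "(\<lambda>k. A k - (p (X + Y + t k *\<^sub>R (H + E)) - X) /\<^sub>R t k) \<longlonglongrightarrow> 0"
    proof (rule Lim_null_comparison)
      show "(\<lambda>k. norm (A k + B k - (H + E))) \<longlonglongrightarrow> 0"
        using tendsto_norm [OF tendsto_diff [OF tendsto_add [OF A B] tendsto_const, of "H + E"]]
        by simp
      have "norm (A k - (p (X + Y + t k *\<^sub>R (H + E)) - X) /\<^sub>R t k) \<le> norm (A k + B k - (H + E))" for k
      proof -
        have pk: "X + t k *\<^sub>R A k = p (X + Y + t k *\<^sub>R (A k + B k))"
          using gr [of k] by (simp add: normal_psd_iff_closest_point p_def algebra_simps)
        have "dist (p (X + Y + t k *\<^sub>R (A k + B k))) (p (X + Y + t k *\<^sub>R (H + E)))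
            \<le> dist (X + Y + t k *\<^sub>R (A k + B k)) (X + Y + t k *\<^sub>R (H + E))"
          unfolding p_def
          by (rule closest_point_lipschitz [OF convex_psd_cone closed_psd_cone psd_cone_nonempty])
        also have "\<dots> = norm (t k *\<^sub>R (A k + B k - (H + E)))"
          by (simp add: dist_norm scaleR_diff_right)
        also have "\<dots> = t k * norm (A k + B k - (H + E))"
          using t(1) [of k] by simp
        finally have le: "norm (X + t k *\<^sub>R A k - p (X + Y + t k *\<^sub>R (H + E)))
            \<le> t k * norm (A k + B k - (H + E))"
          by (simp add: dist_norm pk)
        have "X + t k *\<^sub>R A k - p (X + Y + t k *\<^sub>R (H + E))
            = t k *\<^sub>R (A k - (p (X + Y + t k *\<^sub>R (H + E)) - X) /\<^sub>R t k)"
          using t(1) [of k] by (simp add: scaleR_diff_right)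
        then have "t k * norm (A k - (p (X + Y + t k *\<^sub>R (H + E)) - X) /\<^sub>R t k)
            \<le> t k * norm (A k + B k - (H + E))"
          using le t(1) [of k] by simp
        then show ?thesis using t(1) [of k] by (simp only: mult_le_cancel_left_pos)
      qed
      then show "\<forall>\<^sub>F k in sequentially. norm (A k - (p (X + Y + t k *\<^sub>R (H + E)) - X) /\<^sub>R t k)
          \<le> norm (A k + B k - (H + E))"
        by simp
    qed
    ultimately have "A \<longlonglongrightarrow> directional_derivative p (X + Y) (H + E)"
      using tendsto_add by fastforce
    with A Es show "E \<in> sym_mats \<and>
        H = directional_derivative (closest_point psd_cone) (X + Y) (H + E)"
      using LIMSEQ_unique p_def by blast
  next
    assume "E \<in> sym_mats \<and>
      H = directional_derivative (closest_point psd_cone) (X + Y) (H + E)"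
    then have Es: "E \<in> sym_mats" and HE: "H = directional_derivative p (X + Y) (H + E)"
      by (auto simp: p_def)
    define t where "t k = inverse (real (Suc k))" for k
    define A where "A k = (p (X + Y + t k *\<^sub>R (H + E)) - X) /\<^sub>R t k" for k
    have t: "\<And>k. 0 < t k" "t \<longlonglongrightarrow> 0"
      using LIMSEQ_inverse_real_of_nat by (auto simp: t_def [abs_def])
    have A: "A \<longlonglongrightarrow> H"
      using filterlim_compose [OF deriv [OF Es] at_right [OF t]] HE by (simp add: A_def [abs_def])
    then have lim: "(\<lambda>k. (A k, H + E - A k)) \<longlonglongrightarrow> (H, E)"
      using tendsto_Pair [OF A tendsto_diff [OF tendsto_const A, of "H + E"]] by simp
    have "(A k, H + E - A k) \<in> (\<lambda>u. (u - (X, Y)) /\<^sub>R t k) ` gph normal_psd" for k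
    proof -
      \<comment> \<open>The graph point over \<open>X + Y + t k *\<^sub>R (H + E)\<close>; its
        scaled displacement from \<open>(X, Y)\<close> is \<open>(A k, H + E - A k)\<close>.\<close>
      define x where "x = p (X + Y + t k *\<^sub>R (H + E))"
      define y where "y = X + Y + t k *\<^sub>R (H + E) - x"
      have "y \<in> sym_mats"
        unfolding y_def x_def p_def
        by (intro subspace_add subspace_diff subspace_scale subspace_sym_mats Xs Ys H Es
            closest_point_psd_in_sym)
      moreover have "x + y = X + Y + t k *\<^sub>R (H + E)" by (simp add: y_def)
      ultimately have "y \<in> normal_psd x"
        by (simp add: normal_psd_iff_closest_point x_def p_def)
      moreover have "A k = (x - X) /\<^sub>R t k" by (simp add: A_def x_def)
      moreover have "H + E - A k = (y - Y) /\<^sub>R t k"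
      proof -
        have "y - Y = t k *\<^sub>R (H + E) - (x - X)" by (simp add: y_def)
        then show ?thesis
          using t(1) [of k] by (simp add: scaleR_diff_right \<open>A k = (x - X) /\<^sub>R t k\<close>)
      qed
      ultimately show ?thesis
        by (intro image_eqI [of _ _ "(x, y)"]) (auto simp: gph_def)
    qed
    with t lim show "E \<in> graphical_derivative normal_psd X Y H"
      unfolding graphical_derivative_def tangent_cone_def by blast
  qed
qed

text \<open>The difference quotients stay in the subspace, and closedness keeps their limit there.
  For symmetric-valued \<open>G\<close> this makes the directions \<open>G'(x) \<xi>\<close>
  symmetric.\<close>

lemma has_derivative_in_closed_subspace:
  fixes G :: "'a::real_normed_vector \<Rightarrow> 'b::real_normed_vector"
  assumes "(G has_derivative G') (at x)" and S: "subspace S" "closed S" and "\<And>u. G u \<in> S"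
  shows "G' h \<in> S"
proof -
  have "(\<lambda>k. (G (x + inverse (real (Suc k)) *\<^sub>R h) - G x) /\<^sub>R inverse (real (Suc k))) \<longlonglongrightarrow> G' h"
  proof -
    have "((\<lambda>t. G (x + t *\<^sub>R h)) has_derivative (\<lambda>t. G' (t *\<^sub>R h))) (at 0)"
    proof (rule has_derivative_compose [where g = G])
      show "((\<lambda>t. x + t *\<^sub>R h) has_derivative (\<lambda>t. t *\<^sub>R h)) (at 0)"
        by (auto intro!: derivative_eq_intros)
      show "(G has_derivative G') (at (x + 0 *\<^sub>R h))" using assms(1) by simp
    qed
    then have "((\<lambda>t. norm (G (x + t *\<^sub>R h) - G x - G' (t *\<^sub>R h)) / norm t) \<longlongrightarrow> 0) (at 0)"
      unfolding has_derivative_at by simp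
    then have "((\<lambda>t. norm ((G (x + t *\<^sub>R h) - G x) /\<^sub>R t - G' h)) \<longlongrightarrow> 0) (at 0)"
    proof (rule Lim_transform_eventually)
      have eq: "norm (G (x + t *\<^sub>R h) - G x - G' (t *\<^sub>R h)) / norm t
          = norm ((G (x + t *\<^sub>R h) - G x) /\<^sub>R t - G' h)" if "t \<noteq> 0" for t
      proof -
        have "(G (x + t *\<^sub>R h) - G x) /\<^sub>R t - G' h
            = (G (x + t *\<^sub>R h) - G x - G' (t *\<^sub>R h)) /\<^sub>R t"
          using that
          by (simp add: linear_scale [OF has_derivative_linear [OF assms(1)]] scaleR_diff_right)
        then have "norm ((G (x + t *\<^sub>R h) - G x) /\<^sub>R t - G' h)
            = \<bar>inverse t\<bar> * norm (G (x + t *\<^sub>R h) - G x - G' (t *\<^sub>R h))"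
          by (simp only: norm_scaleR)
        then show ?thesis by (simp only: abs_inverse divide_inverse_commute real_norm_def)
      qed
      show "\<forall>\<^sub>F t in at 0. norm (G (x + t *\<^sub>R h) - G x - G' (t *\<^sub>R h)) / norm t
          = norm ((G (x + t *\<^sub>R h) - G x) /\<^sub>R t - G' h)"
        unfolding eventually_at_filter by (intro always_eventually allI impI eq)
    qed
    then have "((\<lambda>t. (G (x + t *\<^sub>R h) - G x) /\<^sub>R t) \<longlongrightarrow> G' h) (at 0)"
      by (rule LIM_zero_cancel [OF tendsto_norm_zero_cancel])
    then show ?thesis
      by (rule filterlim_compose)
        (simp add: filterlim_at LIMSEQ_inverse_real_of_nat del: of_nat_Suc)
  qed
  moreover have "(G (x + inverse (real (Suc k)) *\<^sub>R h) - G x) /\<^sub>R inverse (real (Suc k)) \<in> S" for k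
    by (intro subspace_scale subspace_diff S assms)
  ultimately show ?thesis
    by (rule closed_sequentially [OF S(2), rotated])
qed

section \<open>Equivalence of the criticality inclusion and the projection system\<close>

theorem theorem3p1:
  fixes f :: "real^'n \<Rightarrow> real" and G :: "real^'n \<Rightarrow> real^'p^'p"
    and xbar :: "real^'n" and ybar :: "real^'p^'p"
  assumes "twice_continuously_differentiable f"
    and "twice_continuously_differentiable G"
    and "\<forall>x. G x \<in> sym_mats"
    and "kkt_point f G xbar ybar"
  shows "noncritical_multiplier f G xbar ybar \<longleftrightarrow>
    (\<forall>\<xi> :: real^'n. \<forall>\<eta> \<in> sym_mats.
      hessian (\<lambda>u. lagrangian f G u ybar) xbar \<xi>
        + adjoint (frechet_derivative G (at xbar)) \<eta> = 0 \<and>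
      frechet_derivative G (at xbar) \<xi>
        - directional_derivative (closest_point psd_cone) (G xbar + ybar)
            (frechet_derivative G (at xbar) \<xi> + \<eta>) = 0
      \<longrightarrow> \<xi> = 0)"
proof -
  have mult: "ybar \<in> multipliers f G xbar" and nor: "ybar \<in> normal_psd (G xbar)"
    using assms(4) by (auto simp: kkt_point_def multipliers_def)
  have "(G has_derivative frechet_derivative G (at xbar)) (at xbar)"
    using assms(2)
    by (metis twice_continuously_differentiable_def differentiableI frechet_derivative_works)
  then have "frechet_derivative G (at xbar) \<xi> \<in> sym_mats" for \<xi>
    using has_derivative_in_closed_subspace subspace_sym_mats closed_sym_mats assms(3) by blast
  \<comment> \<open>Membership in the graphical derivative is the second equation of the system
    together with symmetry of \<open>\<eta>\<close>. The first equation is what the inclusion for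
    zero asserts of such an \<open>\<eta>\<close>.\<close>
  then have "\<eta> \<in> graphical_derivative normal_psd (G xbar) ybar (frechet_derivative G (at xbar) \<xi>) \<longleftrightarrow>
      \<eta> \<in> sym_mats \<and> frechet_derivative G (at xbar) \<xi>
        - directional_derivative (closest_point psd_cone) (G xbar + ybar)
            (frechet_derivative G (at xbar) \<xi> + \<eta>) = 0" for \<xi> \<eta>
    using graphical_derivative_normal_psd_iff [OF nor] by simp
  then show ?thesis
    using mult unfolding noncritical_multiplier_def critical_multiplier_def image_iff
    by metis
qed

end
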